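(* For all integers $x\geq1$ and $y$, the number $S(x,y)$ is given by $$S(x,y)=\sum_{r=0}^{x-1}\binom{x-1}{r}\binom{x-r-1}{\frac{x-y-r}{2}}=\sum_{d=0}^{\lfloor\frac{x-y}{2}\rfloor}\binom{x-1}{d}\binom{x-d-1}{x-y-2d}.$$
   Context: $S(x,y)$ denotes the number of lattice paths in the whole plane $\mathbb{Z}^2$ (not restricted to any table) from $(1,1)$ to $(x,y)$ with steps in $\{(1,1),(1,0),(1,-1)\}$, where $x$ is the column and $y$ the row coordinate. A binomial coefficient $\binom{a}{b}$ is $0$ when $b$ is not an integer with $0\leq b\leq a$, and its product with any other factor is then $0$ (this includes the case of negative $a$). A sum whose upper limit is less than its lower limit is $0$. *)

theory Defs
  imports Complex_Main "HOL-Library.Product_Plus"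
begin

definition steps :: "(int \<times> int) set" where
  "steps = {(1, 1), (1, 0), (1, -1)}"

text \<open>A lattice path is the nonempty list of the points of \<open>\<int> \<times> \<int>\<close> that it visits,
  written (column, row), endpoints included.\<close>

definition lattice_path :: "int \<times> int \<Rightarrow> int \<times> int \<Rightarrow> (int \<times> int) list \<Rightarrow> bool" where
  "lattice_path a b ps \<longleftrightarrow>
     ps \<noteq> [] \<and> hd ps = a \<and> last ps = b \<and> successively (\<lambda>p q. q - p \<in> steps) ps"

text \<open>The set counted here is always finite, since each step advances the column by one;
  so \<open>card\<close> is the true number of paths.\<close>

definition S :: "int \<Rightarrow> int \<Rightarrow> nat" where
  "S x y = card {ps. lattice_path (1, 1) (x, y) ps}"

text \<open>The binomial coefficient with an arbitrary integer on top and a possibly fractional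
  number below; it vanishes unless the lower entry is an integer between 0 and the upper one.
  (The library's \<open>choose\<close> takes only natural numbers, and \<open>gchoose\<close> does not
  vanish for a negative upper entry.)\<close>

definition binom :: "int \<Rightarrow> rat \<Rightarrow> nat" where
  "binom a b = (if b \<in> \<int> \<and> 0 \<le> b \<and> b \<le> of_int a then nat a choose nat \<lfloor>b\<rfloor> else 0)"

end

theory Submission
  imports Defs "HOL-Computational_Algebra.Polynomial"
begin

text \<open>With \<open>n = x - 1\<close>, weigh an up, level or down step by \<open>1\<close>, \<open>z\<close> or \<open>z\<^sup>2\<close>:
  a path of \<open>n\<close> steps ending in row \<open>y\<close> then has weight \<open>z\<close> to the power \<open>x - y\<close>, so \<open>S x y\<close> is a
  coefficient of \<open>(1 + z + z\<^sup>2)\<^sup>n\<close>. Expanding this by the binomial theorem as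
  \<open>(z + (1 + z\<^sup>2))\<^sup>n\<close> and as \<open>(z\<^sup>2 + (1 + z))\<^sup>n\<close> gives the two sums.\<close>

text \<open>Every step advances the column by one, so the endpoints alone fix the number of points
  on a path.\<close>

lemma lattice_path_column:
  "lattice_path a b ps \<Longrightarrow> fst b = fst a + int (length ps) - 1"
proof (induction ps arbitrary: a)
  case Nil
  then show ?case by (simp add: lattice_path_def)
next
  case (Cons p ps)
  show ?case
  proof (cases "ps = []")
    case True
    then show ?thesis using Cons.prems by (auto simp: lattice_path_def)
  next
    case False
    then have "lattice_path (hd ps) b ps" and "hd ps - a \<in> steps"
      using Cons.prems by (auto simp: lattice_path_def successively_Cons)
    moreover from this(2) have "fst (hd ps) = fst a + 1"
      by (cases "hd ps"; cases a) (auto simp: steps_def)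
    ultimately show ?thesis using Cons.IH by fastforce
  qed
qed

text \<open>Base case of the inductions on the number of steps: by the column count such a path is a
  single point.\<close>

lemma lattice_path_same_column:
  assumes "fst a = fst b"
  shows "{ps. lattice_path a b ps} = (if a = b then {[a]} else {})"
proof -
  have "lattice_path a b ps \<longleftrightarrow> a = b \<and> ps = [a]" for ps
  proof
    assume *: "lattice_path a b ps"
    then have "length ps = Suc 0"
      using lattice_path_column[OF *] assms by simp
    then show "a = b \<and> ps = [a]"
      using * by (auto simp: length_Suc_conv lattice_path_def)
  qed (auto simp: lattice_path_def)
  then show ?thesis by auto
qed

lemma lattice_path_first_step:
  assumes "a \<noteq> b"
  shows "{ps. lattice_path a b ps} = (\<Union>s\<in>steps. (#) a ` {ps. lattice_path (a + s) b ps})"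
proof (intro equalityI subsetI)
  fix ps assume "ps \<in> {ps. lattice_path a b ps}"
  then have ps: "lattice_path a b ps" by simp
  then obtain qs where qs: "ps = a # qs"
    by (cases ps) (auto simp: lattice_path_def)
  with ps assms have "qs \<noteq> []" by (auto simp: lattice_path_def)
  with ps qs have "hd qs - a \<in> steps" "lattice_path (a + (hd qs - a)) b qs"
    by (auto simp: lattice_path_def successively_Cons)
  with qs show "ps \<in> (\<Union>s\<in>steps. (#) a ` {ps. lattice_path (a + s) b ps})" by blast
qed (auto simp: lattice_path_def successively_Cons)

lemma finite_lattice_paths:
  "fst b = fst a + int n \<Longrightarrow> finite {ps. lattice_path a b ps}"
proof (induction n arbitrary: a)
  case 0
  then show ?case by (simp add: lattice_path_same_column)
next
  case (Suc n)
  then have "finite {ps. lattice_path (a + s) b ps}" if "s \<in> steps" for s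
    using that by (intro Suc.IH) (auto simp: steps_def)
  moreover have "a \<noteq> b" using Suc.prems by auto
  ultimately show ?case by (auto simp: lattice_path_first_step steps_def)
qed

lemma card_lattice_paths_first_step:
  assumes "fst b = fst a + int (Suc n)"
  shows "card {ps. lattice_path a b ps} = (\<Sum>s\<in>steps. card {ps. lattice_path (a + s) b ps})"
proof -
  have "a \<noteq> b" using assms by auto
  have "card (\<Union>s\<in>steps. (#) a ` {ps. lattice_path (a + s) b ps})
      = (\<Sum>s\<in>steps. card ((#) a ` {ps. lattice_path (a + s) b ps}))"
  proof (rule card_UN_disjoint)
    show "\<forall>s\<in>steps. finite ((#) a ` {ps. lattice_path (a + s) b ps})"
      using assms by (auto intro!: finite_imageI finite_lattice_paths[where n = n] simp: steps_def)
  \<comment> \<open>Disjointness: the second point of a path is \<open>a + s\<close>, which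
    determines \<open>s\<close>.\<close>
  qed (auto simp: lattice_path_def, simp add: steps_def)
  also have "\<dots> = (\<Sum>s\<in>steps. card {ps. lattice_path (a + s) b ps})"
    by (simp add: card_image)
  finally show ?thesis by (simp add: lattice_path_first_step[OF \<open>a \<noteq> b\<close>])
qed

text \<open>Integer indices let the recursion shift below zero and cover end rows out of reach
  above, with no case distinctions.\<close>

definition coeff_int :: "'a::zero poly \<Rightarrow> int \<Rightarrow> 'a" where
  "coeff_int p k = (if k < 0 then 0 else coeff p (nat k))"

lemma coeff_int_sum: "coeff_int (\<Sum>i\<in>A. f i) k = (\<Sum>i\<in>A. coeff_int (f i) k)"
  by (simp add: coeff_int_def coeff_sum)

lemma coeff_int_monom_mult:
  fixes c :: "'a::comm_semiring_1"
  shows "coeff_int (monom c j * p) k = c * coeff_int p (k - int j)"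
  by (auto simp: coeff_int_def coeff_monom_mult nat_diff_distrib)

lemma coeff_int_trinomial_mult:
  fixes p :: "'a::comm_semiring_1 poly"
  shows "coeff_int ([:1, 1, 1:] * p) k = coeff_int p k + coeff_int p (k - 1) + coeff_int p (k - 2)"
proof -
  have "[:1, 1, 1:] * p = monom 1 0 * p + monom 1 1 * p + monom 1 2 * p"
    by (simp add: monom_altdef algebra_simps power2_eq_square)
  then have "coeff_int ([:1, 1, 1:] * p) k
      = coeff_int (monom 1 0 * p) k + coeff_int (monom 1 1 * p) k + coeff_int (monom 1 2 * p) k"
    by (simp only:) (simp add: coeff_int_def)
  then show ?thesis by (simp add: coeff_int_monom_mult)
qed

text \<open>Splitting off the first step matches multiplication by the trinomial: an up, level or
  down step lowers the index by 0, 1 or 2.\<close>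

lemma card_lattice_paths:
  "fst b = fst a + int n \<Longrightarrow>
    card {ps. lattice_path a b ps} = coeff_int ([:1, 1, 1:] ^ n) (int n - (snd b - snd a))"
proof (induction n arbitrary: a)
  case 0
  then show ?case
    by (cases a; cases b) (auto simp: lattice_path_same_column coeff_int_def)
next
  case (Suc n)
  have "card {ps. lattice_path (a + s) b ps}
      = coeff_int ([:1, 1, 1:] ^ n) (int n - (snd b - snd (a + s)))" if "s \<in> steps" for s
    using that Suc.prems by (intro Suc.IH) (auto simp: steps_def)
  then have "card {ps. lattice_path a b ps}
      = (\<Sum>s\<in>steps. coeff_int ([:1, 1, 1:] ^ n) (int n - (snd b - snd (a + s))))"
    by (simp add: card_lattice_paths_first_step[OF Suc.prems])
  also have "\<dots> = coeff_int ([:1, 1, 1:] ^ Suc n) (int (Suc n) - (snd b - snd a))"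
    unfolding power_Suc coeff_int_trinomial_mult by (simp add: steps_def algebra_simps)
  finally show ?case .
qed

text \<open>The binomial theorem, summed over integers to match the index sets of the final
  formulas.\<close>

lemma coeff_int_binomial_power:
  fixes q :: "'a::comm_semiring_1 poly"
  shows "coeff_int ((monom 1 j + q) ^ n) k
    = (\<Sum>r\<in>{0..int n}. of_nat (n choose nat r) * coeff_int (q ^ (n - nat r)) (k - int j * r))"
proof -
  have "(monom 1 j + q) ^ n = (\<Sum>r\<le>n. monom (of_nat (n choose r)) (j * r) * q ^ (n - r))"
    by (simp add: binomial_ring monom_power of_nat_monom mult_monom)
  then have "coeff_int ((monom 1 j + q) ^ n) k
      = (\<Sum>r\<le>n. of_nat (n choose r) * coeff_int (q ^ (n - r)) (k - int (j * r)))"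
    by (simp add: coeff_int_sum coeff_int_monom_mult)
  also have "\<dots> = (\<Sum>r\<in>{0..int n}. of_nat (n choose nat r) * coeff_int (q ^ (n - nat r)) (k - int j * r))"
    by (rule sum.reindex_bij_witness[of _ nat int]) auto
  finally show ?thesis .
qed

text \<open>Expanding with \<open>q = 1\<close> leaves only the term with \<open>j * r = k\<close>.
  It exists exactly when \<open>k / j\<close> is an integer between 0 and \<open>n\<close>;
  otherwise both sides are 0, by the default value of \<open>binom\<close>.\<close>

lemma coeff_int_one_plus_monom_power:
  assumes "j > 0"
  shows "coeff_int ((1 + monom 1 j) ^ n) k = binom (int n) (of_int k / of_nat j)"
proof -
  have *: "coeff_int ((1 + monom 1 j) ^ n :: nat poly) k
      = (\<Sum>r\<in>{0..int n}. if k = int j * r then n choose nat r else 0)"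
    unfolding add.commute[of 1] coeff_int_binomial_power
    by (intro sum.cong) (auto simp: coeff_int_def)
  show ?thesis
  proof (cases "\<exists>r. k = int j * r")
    case True
    then obtain r where k: "k = int j * r" by blast
    with assms have "rat_of_int k / of_nat j = of_int r" by simp
    then show ?thesis
      using assms unfolding * by (auto simp: k binom_def)
  next
    case False
    have "rat_of_int k / of_nat j \<notin> \<int>"
    proof
      assume "rat_of_int k / of_nat j \<in> \<int>"
      then obtain r where "rat_of_int k / of_nat j = of_int r" by (elim Ints_cases)
      then have "rat_of_int k = of_int (int j * r)" using assms by (simp add: field_simps)
      then show False using False by (simp only: of_int_eq_iff) blast
    qed
    with False show ?thesis unfolding * by (simp add: binom_def)
  qed
qed

lemma binom_int_nat: "0 \<le> r \<Longrightarrow> binom (int n) (of_int r) = n choose nat r"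
  by (auto simp: binom_def)

theorem theorem3p1:
  fixes x y :: int
  assumes "x \<ge> 1"
  shows "S x y = (\<Sum>r\<in>{0..x - 1}. binom (x - 1) (of_int r) * binom (x - r - 1) (of_int (x - y - r) / 2))
    \<and> (\<Sum>r\<in>{0..x - 1}. binom (x - 1) (of_int r) * binom (x - r - 1) (of_int (x - y - r) / 2))
      = (\<Sum>d\<in>{0..\<lfloor>of_int (x - y) / (2 :: rat)\<rfloor>}. binom (x - 1) (of_int d) * binom (x - d - 1) (of_int (x - y - 2 * d)))"
proof -
  define n where "n = nat (x - 1)"
  have x: "x = int n + 1" using assms by (simp add: n_def)
  let ?t = "[:1, 1, 1:] :: nat poly"
  have t1: "?t = monom 1 1 + (1 + monom 1 2)" and t2: "?t = monom 1 2 + (1 + monom 1 1)"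
    by (simp_all add: monom_altdef power2_eq_square one_pCons)
  \<comment> \<open>Paths start in row 1, so the index is
    \<open>n - (y - 1) = x - y\<close>.\<close>
  have paths: "S x y = coeff_int (?t ^ n) (x - y)"
    unfolding S_def by (subst card_lattice_paths[where n = n]) (auto simp: x algebra_simps)
  \<comment> \<open>Here \<open>r\<close> counts the level steps, and \<open>(x - y - r) / 2\<close>
    the down steps among the others.\<close>
  have sum1: "coeff_int (?t ^ n) (x - y)
      = (\<Sum>r\<in>{0..x - 1}. binom (x - 1) (of_int r) * binom (x - r - 1) (of_int (x - y - r) / 2))"
    unfolding t1 coeff_int_binomial_power
    by (intro sum.cong) (auto simp: x coeff_int_one_plus_monom_power binom_int_nat of_nat_diff simp del: One_nat_def)
  \<comment> \<open>Here \<open>d\<close> counts the down steps, and \<open>x - y - 2 * d\<close>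
    the level steps among the others.\<close>
  have "coeff_int (?t ^ n) (x - y)
      = (\<Sum>d\<in>{0..x - 1}. binom (x - 1) (of_int d) * binom (x - d - 1) (of_int (x - y - 2 * d)))"
    unfolding t2 coeff_int_binomial_power
    by (intro sum.cong) (auto simp: x coeff_int_one_plus_monom_power binom_int_nat of_nat_diff simp del: One_nat_def)
  also have "\<dots> = (\<Sum>d\<in>{0..\<lfloor>of_int (x - y) / (2 :: rat)\<rfloor>}.
      binom (x - 1) (of_int d) * binom (x - d - 1) (of_int (x - y - 2 * d)))"
  \<comment> \<open>Either range may be the longer one, but terms outside the overlap vanish: past
    the floor the second factor has a negative lower entry, and past \<open>x - 1\<close> the first
    has a lower entry above its upper one.\<close>
  proof (rule sum.mono_neutral_cong)
    fix d assume "d \<in> {0..x - 1} - {0..\<lfloor>of_int (x - y) / (2 :: rat)\<rfloor>}"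
    then have "x - y - 2 * d < 0"
      using floor_divide_of_int_eq[of "x - y" 2, where 'a = rat] by auto
    then show "binom (x - 1) (of_int d) * binom (x - d - 1) (of_int (x - y - 2 * d)) = 0"
      unfolding binom_def of_int_0_le_iff by simp
  next
    fix d assume "d \<in> {0..\<lfloor>of_int (x - y) / (2 :: rat)\<rfloor>} - {0..x - 1}"
    then show "binom (x - 1) (of_int d) * binom (x - d - 1) (of_int (x - y - 2 * d)) = 0"
      unfolding binom_def of_int_le_iff by auto
  qed auto
  finally show ?thesis using paths sum1 by simp
qed

end
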